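(* Let $\lambda$ be a nonzero real number. For all positive integers $\alpha,n$ with $n>\alpha$, $$ {n \brace \alpha}_{\lambda}=\sum_{k=1}^{\alpha}\big(\alpha-k+1-\lambda(n-k)\big){n-k \brace \alpha-k+1}_{\lambda}. $$
   Context: For a real parameter $\mu$ the degenerate falling factorials are $(x)_{0,\mu}=1$ and $(x)_{n,\mu}=x(x-\mu)(x-2\mu)\cdots(x-(n-1)\mu)$ for $n\ge1$; the falling factorials are $(x)_n=(x)_{n,1}$, i.e. $(x)_0=1$, $(x)_n=x(x-1)\cdots(x-n+1)$. The degenerate Stirling numbers of the second kind ${n \brace k}_{\mu}$ ($0\le k\le n$) are defined by the polynomial identity $(x)_{n,\mu}=\sum_{k=0}^{n}{n \brace k}_{\mu}(x)_k$, with ${n \brace k}_{\mu}=0$ for $k>n$. *)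

theory Defs
  imports Complex_Main
begin

definition deg_ffact :: "real \<Rightarrow> real \<Rightarrow> nat \<Rightarrow> real" where
  "deg_ffact \<mu> x n = (\<Prod>i<n. x - real i * \<mu>)"

definition ffact :: "real \<Rightarrow> nat \<Rightarrow> real" where
  "ffact x n = deg_ffact 1 x n"

text \<open>
  The family of coefficients is the unique one satisfying the defining polynomial identity
  (see \<open>ex1_deg_Stirling2_coeffs\<close>); a polynomial identity over the reals is
  stated as equality for all real \<open>x\<close>.
\<close>

definition deg_Stirling2_coeffs :: "real \<Rightarrow> nat \<Rightarrow> (nat \<Rightarrow> real) \<Rightarrow> bool" where
  "deg_Stirling2_coeffs \<mu> n c \<longleftrightarrow>
     (\<forall>x. deg_ffact \<mu> x n = (\<Sum>k=0..n. c k * ffact x k)) \<and> (\<forall>k>n. c k = 0)"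

definition deg_Stirling2 :: "real \<Rightarrow> nat \<Rightarrow> nat \<Rightarrow> real" where
  "deg_Stirling2 \<mu> n = (THE c. deg_Stirling2_coeffs \<mu> n c)"

lemma ffact_Suc: "ffact x (Suc k) = ffact x k * (x - real k)"
  by (simp add: ffact_def deg_ffact_def)

lemma ffact_eq_0: "m < k \<Longrightarrow> ffact (real m) k = 0"
  by (auto simp: ffact_def deg_ffact_def)

lemma ffact_self_neq_0: "ffact (real m) m \<noteq> 0"
  by (auto simp: ffact_def deg_ffact_def)

lemma ffact_independent:
  assumes "\<And>x. (\<Sum>k=0..n. c k * ffact x k) = 0" and "m \<le> n"
  shows "c m = 0"
  using assms(2)
proof (induction m rule: less_induct)
  case (less m)
  have "(\<Sum>k=0..n. c k * ffact (real m) k) = (\<Sum>k\<in>{m}. c k * ffact (real m) k)"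
  proof (rule sum.mono_neutral_right)
    show "\<forall>k\<in>{0..n} - {m}. c k * ffact (real m) k = 0"
    proof
      fix k assume k: "k \<in> {0..n} - {m}"
      show "c k * ffact (real m) k = 0"
        using k less.IH[of k] ffact_eq_0[of m k] by (cases "k < m") auto
    qed
  qed (use less.prems in auto)
  then show ?case using assms(1)[of "real m"] ffact_self_neq_0[of m] by simp
qed

lemma ex_deg_Stirling2_coeffs: "\<exists>c. deg_Stirling2_coeffs \<mu> n c"
proof (induction n)
  case 0
  have "deg_Stirling2_coeffs \<mu> 0 (\<lambda>k. if k = 0 then 1 else 0)"
    by (simp add: deg_Stirling2_coeffs_def deg_ffact_def ffact_def)
  then show ?case by blast
next
  case (Suc n)
  then obtain c where c: "\<And>x. deg_ffact \<mu> x n = (\<Sum>k=0..n. c k * ffact x k)"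
    and z: "\<And>k. k > n \<Longrightarrow> c k = 0"
    by (auto simp: deg_Stirling2_coeffs_def)
  define d where "d k = (if k = 0 then 0 else c (k - 1)) + (real k - real n * \<mu>) * c k" for k
  have "deg_ffact \<mu> x (Suc n) = (\<Sum>k=0..Suc n. d k * ffact x k)" for x
  proof -
    have "deg_ffact \<mu> x (Suc n) = (\<Sum>k=0..n. c k * ffact x k) * (x - real n * \<mu>)"
      by (simp add: deg_ffact_def flip: c)
    also have "\<dots> = (\<Sum>k=0..n. c k * ffact x (Suc k) + (real k - real n * \<mu>) * c k * ffact x k)"
      unfolding sum_distrib_right by (rule sum.cong) (auto simp: ffact_Suc algebra_simps)
    also have "\<dots> = (\<Sum>k=0..n. c k * ffact x (Suc k))
        + (\<Sum>k=0..Suc n. (real k - real n * \<mu>) * c k * ffact x k)"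
      by (simp add: sum.distrib z)
    also have "(\<Sum>k=0..n. c k * ffact x (Suc k))
        = (\<Sum>k=0..Suc n. (if k = 0 then 0 else c (k - 1)) * ffact x k)"
      by (subst sum.atLeast0_atMost_Suc_shift) simp
    finally show ?thesis
      by (simp only: d_def sum.distrib distrib_right)
  qed
  moreover have "\<forall>k>Suc n. d k = 0"
    by (auto simp: d_def z)
  ultimately show ?case unfolding deg_Stirling2_coeffs_def by blast
qed

lemma ex1_deg_Stirling2_coeffs: "\<exists>!c. deg_Stirling2_coeffs \<mu> n c"
proof (rule ex_ex1I[OF ex_deg_Stirling2_coeffs])
  fix c d assume cd: "deg_Stirling2_coeffs \<mu> n c" "deg_Stirling2_coeffs \<mu> n d"
  have eq: "(\<Sum>k=0..n. c k * ffact x k) = (\<Sum>k=0..n. d k * ffact x k)" for x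
    using cd unfolding deg_Stirling2_coeffs_def by metis
  have "(\<Sum>k=0..n. (c k - d k) * ffact x k) = 0" for x
    using eq[of x] by (simp add: left_diff_distrib sum_subtractf)
  then have le: "c k = d k" if "k \<le> n" for k
    using ffact_independent[where n = n and c = "\<lambda>k. c k - d k" and m = k] that by simp
  show "c = d"
  proof
    fix k show "c k = d k"
      using le[of k] cd by (cases "k \<le> n") (auto simp: deg_Stirling2_coeffs_def)
  qed
qed

lemma deg_Stirling2_coeffs_deg_Stirling2: "deg_Stirling2_coeffs \<mu> n (deg_Stirling2 \<mu> n)"
  unfolding deg_Stirling2_def by (rule theI'[OF ex1_deg_Stirling2_coeffs])

end

theory Submission imports Defs begin

text \<open>
  Multiplying the defining identity by \<open>x - n\<mu> = (x - k) + (k - n\<mu>)\<close> gives the triangular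
  recurrence; iterating it down the diagonal telescopes to the boundary term at
  \<open>(n - \<alpha>, 0)\<close>, which vanishes because \<open>n > \<alpha>\<close>.
\<close>

lemma deg_Stirling2_eq_0: "k > n \<Longrightarrow> deg_Stirling2 \<mu> n k = 0"
  using deg_Stirling2_coeffs_deg_Stirling2 by (simp add: deg_Stirling2_coeffs_def)

lemma deg_ffact_eq_sum_deg_Stirling2:
  "deg_ffact \<mu> x n = (\<Sum>k=0..n. deg_Stirling2 \<mu> n k * ffact x k)"
  using deg_Stirling2_coeffs_deg_Stirling2 by (simp add: deg_Stirling2_coeffs_def)

lemma deg_Stirling2_unique:
  "deg_Stirling2_coeffs \<mu> n c \<Longrightarrow> deg_Stirling2 \<mu> n = c"
  using ex1_deg_Stirling2_coeffs deg_Stirling2_coeffs_deg_Stirling2 by blast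

text \<open>Evaluating the defining identity at x = 0 isolates the coefficient at k = 0, while the
  product on the left contains the factor 0 as soon as n > 0.\<close>

lemma deg_Stirling2_0_right:
  assumes "n > 0"
  shows "deg_Stirling2 \<mu> n 0 = 0"
proof -
  have "ffact 0 k = 0" if "k > 0" for k
    using ffact_eq_0[of 0 k] that by simp
  then have "deg_ffact \<mu> 0 n = deg_Stirling2 \<mu> n 0"
    unfolding deg_ffact_eq_sum_deg_Stirling2
    by (simp add: sum.atLeast_Suc_atMost ffact_def[of 0 0] deg_ffact_def)
  moreover have "deg_ffact \<mu> 0 n = 0"
    using assms by (auto simp: deg_ffact_def)
  ultimately show ?thesis by simp
qed

text \<open>The right-hand side, as a function \<open>d\<close> of k, satisfies the defining
  identity for \<open>Suc n\<close>, so uniqueness of the coefficients identifies it.\<close>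

lemma deg_Stirling2_Suc:
  "deg_Stirling2 \<mu> (Suc n) k =
     (if k = 0 then 0 else deg_Stirling2 \<mu> n (k - 1)) + (real k - real n * \<mu>) * deg_Stirling2 \<mu> n k"
proof -
  define c where "c = deg_Stirling2 \<mu> n"
  define d where "d k = (if k = 0 then 0 else c (k - 1)) + (real k - real n * \<mu>) * c k" for k
  have z: "c k = 0" if "k > n" for k
    using that by (simp add: c_def deg_Stirling2_eq_0)
  have "deg_ffact \<mu> x (Suc n) = (\<Sum>k=0..Suc n. d k * ffact x k)" for x
  proof -
    have "deg_ffact \<mu> x (Suc n) = deg_ffact \<mu> x n * (x - real n * \<mu>)"
      by (simp add: deg_ffact_def)
    also have "\<dots> = (\<Sum>k=0..n. c k * ffact x (Suc k) + (real k - real n * \<mu>) * c k * ffact x k)"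
      unfolding deg_ffact_eq_sum_deg_Stirling2 c_def sum_distrib_right
      by (rule sum.cong) (auto simp: ffact_Suc algebra_simps)
    \<comment> \<open>Raising the upper limit to \<open>Suc n\<close> adds only a zero term, since
      \<open>c (Suc n) = 0\<close>.\<close>
    also have "\<dots> = (\<Sum>k=0..n. c k * ffact x (Suc k))
        + (\<Sum>k=0..Suc n. (real k - real n * \<mu>) * c k * ffact x k)"
      by (simp add: sum.distrib z)
    \<comment> \<open>The shifted sum has no term at k = 0; the conditional records this and keeps
      the truncated \<open>k - 1\<close> harmless.\<close>
    also have "(\<Sum>k=0..n. c k * ffact x (Suc k))
        = (\<Sum>k=0..Suc n. (if k = 0 then 0 else c (k - 1)) * ffact x k)"
      by (subst sum.atLeast0_atMost_Suc_shift) simp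
    finally show ?thesis
      by (simp only: d_def sum.distrib distrib_right)
  qed
  then have "deg_Stirling2_coeffs \<mu> (Suc n) d"
    by (auto simp: deg_Stirling2_coeffs_def d_def z)
  then show ?thesis
    by (simp add: deg_Stirling2_unique d_def c_def)
qed

text \<open>Induction on \<open>a\<close> with \<open>n\<close> arbitrary, because one use of the
  recurrence lowers both arguments. It starts at \<open>a = 0\<close>, where the sum is
  empty.\<close>

lemma deg_Stirling2_diagonal_sum:
  assumes "n > a"
  shows "deg_Stirling2 \<mu> n a =
    (\<Sum>k=1..a. (real a - real k + 1 - \<mu> * (real n - real k)) * deg_Stirling2 \<mu> (n - k) (a - k + 1))"
  using assms
proof (induction a arbitrary: n)
  case 0
  then show ?case by (simp add: deg_Stirling2_0_right)
next
  case (Suc a)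
  then obtain m where n: "n = Suc m" and m: "m > a"
    by (cases n) auto
  \<comment> \<open>The term k = 1 is the second summand of the recurrence for \<open>Suc m\<close>.
    The other terms depend only on differences with k, so shifting k by one turns them into the sum
    for \<open>m\<close> and \<open>a\<close>, which the induction hypothesis evaluates.\<close>
  have "(\<Sum>k=1..Suc a. (real (Suc a) - real k + 1 - \<mu> * (real n - real k))
           * deg_Stirling2 \<mu> (n - k) (Suc a - k + 1))
      = (real (Suc a) - real m * \<mu>) * deg_Stirling2 \<mu> m (Suc a)
        + (\<Sum>k=1..a. (real a - real k + 1 - \<mu> * (real m - real k))
             * deg_Stirling2 \<mu> (m - k) (a - k + 1))"
    by (subst sum.atLeast_Suc_atMost)
       (simp_all add: n sum.atLeast_Suc_atMost_Suc_shift mult.commute add.commute del: sum.cl_ivl_Suc)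
  then show ?case
    unfolding n deg_Stirling2_Suc[of \<mu> m] using Suc.IH[OF m] by simp
qed

theorem theorem2p1:
  fixes lam :: real and \<alpha> n :: nat
  assumes "lam \<noteq> 0" and "\<alpha> > 0" and "n > 0" and "n > \<alpha>"
  shows "deg_Stirling2 lam n \<alpha> =
    (\<Sum>k=1..\<alpha>. (real \<alpha> - real k + 1 - lam * (real n - real k))
                 * deg_Stirling2 lam (n - k) (\<alpha> - k + 1))"
  using assms(4) by (rule deg_Stirling2_diagonal_sum)

end
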